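(* Let $\mathbf U=(D,\mathbf m^\top,\mathbf B^\top,E)^\top\in\mathcal G$ and consider a general equation of state $h=\mathcal H(\rho,p)$ satisfying conditions (i)--(iv) of the context, with associated function $\mathcal F$. Assume that either $\mathcal F'$ is monotone on $\Omega_2=(\xi_b,+\infty)$, or there is a point $\xi_{in}\in\Omega_2$ such that $\mathcal F'$ is monotonically decreasing on $(\xi_b,\xi_{in}]$ and monotonically increasing on $[\xi_{in},+\infty)$. If the initial guess satisfies $\xi_0\in\Omega_3:=(\xi_b,\xi_*]$, then the Newton--Raphson iteration $\xi_{n+1}=\xi_n-\mathcal F(\xi_n)/\mathcal F'(\xi_n)$, $n=0,1,2,\dots$, is physical-constraint-preserving (PCP), that is, for all $n\ge0$ $$\xi_n\in\Omega_1,\quad \rho(\xi_n)>0,\quad p(\xi_n)>0,\quad |\mathbf v(\xi_n)|<1,$$ and it is convergent, that is, $\lim_{n\to\infty}\xi_n=\xi_*$.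
   Context: Conservative vectors are $\mathbf U=(D,\mathbf m^\top,\mathbf B^\top,E)^\top$ with $D,E\in\mathbb R$ and $\mathbf m,\mathbf B\in\mathbb R^3$. Write $m=|\mathbf m|$, $B=|\mathbf B|$, $\tau=\mathbf m\cdot\mathbf B$. The admissible set $\mathcal G$ is the set of all $\mathbf U$ with $D>0$, $E-\sqrt{D^2+m^2}>0$ and $\Psi(\mathbf U)>0$, where $$\Phi(\mathbf U)=\sqrt{(B^2-E)^2+3(E^2-D^2-m^2)},$$ $$\Psi(\mathbf U)=\big(\Phi(\mathbf U)-2(B^2-E)\big)\sqrt{\Phi(\mathbf U)+B^2-E}-\sqrt{\tfrac{27}{2}(D^2B^2+\tau^2)}.$$ Equation of state: $h=\mathcal H(\rho,p)$ for $\rho,p>0$, where (i) $\mathcal H$ is differentiable on $\mathbb R^+\times\mathbb R^+$; (ii) $\mathcal H(\rho,p)\ge\sqrt{1+p^2/\rho^2}+p/\rho$ for all $p,\rho>0$; (iii) $\mathcal H(\rho,p)\big(\frac1\rho-\frac{\partial\mathcal H}{\partial p}(\rho,p)\big)<\frac{\partial\mathcal H}{\partial\rho}(\rho,p)<0$ for all $p,\rho>0$; (iv) $\lim_{p\to0^+}\mathcal H(\rho,p)=1$ for all $\rho>0$. Under these conditions, for every $\rho>0$ and $h>1$ there is a unique $p>0$ with $\mathcal H(\rho,p)=h$; it is denoted $p=\mathcal P(\rho,h)$. No positive pressure corresponds to $h\le1$, so the statement "$\mathcal P(\rho,h)>0$" is understood to be false when $h\le 1$. Define $$f_a(\xi)=\xi^2(\xi+B^2)^2-\big(\xi^2m^2+(2\xi+B^2)\tau^2\big),\qquad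 f_b(\xi)=f_a(\xi)-D^2(\xi+B^2)^2.$$ For $\mathbf U\in\mathcal G$ it is known that $f_a$ has at least one non-negative root. Let $\xi_a$ be its largest non-negative root; then $\Omega_1:=\{\xi>0:f_a(\xi)>0\}=(\xi_a,+\infty)$. It is known that $f_b$ has a unique root $\xi_b$ in $\Omega_1$; put $\Omega_2:=(\xi_b,+\infty)$. Let $$\mathcal W(\xi)=\frac{\xi(\xi+B^2)}{\sqrt{f_a(\xi)}},\qquad \mathcal F(\xi)=\xi-\mathcal P\Big(\frac{D}{\mathcal W(\xi)},\frac{\xi}{D\mathcal W(\xi)}\Big)-\frac12\Big(\frac{B^2}{\mathcal W(\xi)^2}+\frac{\tau^2}{\xi^2}\Big)+B^2-E.$$ On $\Omega_2$ one has $\xi/(D\mathcal W(\xi))>1$. It is known that $\mathcal F'>0$ on $\Omega_2$ and that $\mathcal F$ has a unique root in $\Omega_2$, denoted $\xi_*$. For $\xi\in\Omega_1$ define $\mathbf v(\xi)=\frac{\mathbf m+\xi^{-1}\tau\mathbf B}{\xi+B^2}$, $\rho(\xi)=\frac{D}{\mathcal W(\xi)}$, $h(\xi)=\frac{\xi}{D\mathcal W(\xi)}$, $p(\xi)=\mathcal P(\rho(\xi),h(\xi))$. *)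

theory Defs
  imports "HOL-Analysis.Analysis"
begin

record conservative =
  dens :: real
  mom :: "real ^ 3"
  mag :: "real ^ 3"
  ener :: real

definition tau :: "conservative \<Rightarrow> real" where
  "tau U = mom U \<bullet> mag U"

definition Phi :: "conservative \<Rightarrow> real" where
  "Phi U = sqrt (((norm (mag U))^2 - ener U)^2
      + 3 * ((ener U)^2 - (dens U)^2 - (norm (mom U))^2))"

definition Psi :: "conservative \<Rightarrow> real" where
  "Psi U = (Phi U - 2 * ((norm (mag U))^2 - ener U)) * sqrt (Phi U + (norm (mag U))^2 - ener U)
      - sqrt (27 / 2 * ((dens U)^2 * (norm (mag U))^2 + (tau U)^2))"

definition admissible :: "conservative set" where
  "admissible = {U. dens U > 0 \<and> ener U - sqrt ((dens U)^2 + (norm (mom U))^2) > 0 \<and> Psi U > 0}"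

text \<open>The enthalpy \<open>H \<rho> p\<close> is differentiable jointly in both arguments (Frechet); its partial
  derivatives are \<open>deriv (\<lambda>r. H r p) \<rho>\<close> and \<open>deriv (H \<rho>) p\<close>.\<close>

definition general_eos :: "(real \<Rightarrow> real \<Rightarrow> real) \<Rightarrow> bool" where
  "general_eos H \<longleftrightarrow>
     (\<lambda>(\<rho>, p). H \<rho> p) differentiable_on ({0<..} \<times> {0<..}) \<and>
     (\<forall>\<rho>>0. \<forall>p>0. H \<rho> p \<ge> sqrt (1 + p^2 / \<rho>^2) + p / \<rho>) \<and>
     (\<forall>\<rho>>0. \<forall>p>0. H \<rho> p * (1 / \<rho> - deriv (H \<rho>) p) < deriv (\<lambda>r. H r p) \<rho> \<and>
                  deriv (\<lambda>r. H r p) \<rho> < 0) \<and>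
     (\<forall>\<rho>>0. (H \<rho> \<longlongrightarrow> 1) (at_right 0))"

text \<open>For \<open>h \<le> 1\<close> no positive pressure exists; the value \<open>0\<close> makes \<open>pressure H \<rho> h > 0\<close> false
  there.\<close>

definition pressure :: "(real \<Rightarrow> real \<Rightarrow> real) \<Rightarrow> real \<Rightarrow> real \<Rightarrow> real" where
  "pressure H \<rho> h = (if h > 1 then (THE p. p > 0 \<and> H \<rho> p = h) else 0)"

definition f_a :: "conservative \<Rightarrow> real \<Rightarrow> real" where
  "f_a U \<xi> = \<xi>^2 * (\<xi> + (norm (mag U))^2)^2
      - (\<xi>^2 * (norm (mom U))^2 + (2 * \<xi> + (norm (mag U))^2) * (tau U)^2)"

definition f_b :: "conservative \<Rightarrow> real \<Rightarrow> real" where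
  "f_b U \<xi> = f_a U \<xi> - (dens U)^2 * (\<xi> + (norm (mag U))^2)^2"

definition Omega1 :: "conservative \<Rightarrow> real set" where
  "Omega1 U = {\<xi>. \<xi> > 0 \<and> f_a U \<xi> > 0}"

definition xi_b :: "conservative \<Rightarrow> real" where
  "xi_b U = (THE \<xi>. \<xi> \<in> Omega1 U \<and> f_b U \<xi> = 0)"

definition Omega2 :: "conservative \<Rightarrow> real set" where
  "Omega2 U = {xi_b U<..}"

definition lorentz :: "conservative \<Rightarrow> real \<Rightarrow> real" where
  "lorentz U \<xi> = \<xi> * (\<xi> + (norm (mag U))^2) / sqrt (f_a U \<xi>)"

definition velocity_at :: "conservative \<Rightarrow> real \<Rightarrow> real ^ 3" where
  "velocity_at U \<xi> = (1 / (\<xi> + (norm (mag U))^2)) *\<^sub>R (mom U + (tau U / \<xi>) *\<^sub>R mag U)"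

definition density_at :: "conservative \<Rightarrow> real \<Rightarrow> real" where
  "density_at U \<xi> = dens U / lorentz U \<xi>"

definition enthalpy_at :: "conservative \<Rightarrow> real \<Rightarrow> real" where
  "enthalpy_at U \<xi> = \<xi> / (dens U * lorentz U \<xi>)"

definition pressure_at :: "(real \<Rightarrow> real \<Rightarrow> real) \<Rightarrow> conservative \<Rightarrow> real \<Rightarrow> real" where
  "pressure_at H U \<xi> = pressure H (density_at U \<xi>) (enthalpy_at U \<xi>)"

definition master_fun :: "(real \<Rightarrow> real \<Rightarrow> real) \<Rightarrow> conservative \<Rightarrow> real \<Rightarrow> real" where
  "master_fun H U \<xi> = \<xi> - pressure_at H U \<xi>
      - 1 / 2 * ((norm (mag U))^2 / (lorentz U \<xi>)^2 + (tau U)^2 / \<xi>^2)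
      + (norm (mag U))^2 - ener U"

definition xi_star :: "(real \<Rightarrow> real \<Rightarrow> real) \<Rightarrow> conservative \<Rightarrow> real" where
  "xi_star H U = (THE \<xi>. \<xi> \<in> Omega2 U \<and> master_fun H U \<xi> = 0)"

definition Omega3 :: "(real \<Rightarrow> real \<Rightarrow> real) \<Rightarrow> conservative \<Rightarrow> real set" where
  "Omega3 H U = {xi_b U<..xi_star H U}"

end

theory Submission
  imports Defs
begin

text \<open>
  Each of the admissible shapes of \<open>\<F>'\<close> makes \<open>\<F>'\<close> quasiconvex.  For an increasing function with
  quasiconvex derivative, Newton's iteration started to the left of the root either increases to the
  root, or overshoots it once; in the latter case the derivative is increasing from some point to the
  left of the root on, so that the iterates then decrease to the root.  Hence they never leave
  \<open>\<Omega>\<^sub>2\<close>.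

  Writing \<open>g = 1 / \<W>\<^sup>2 = 1 - |v|\<^sup>2\<close>, condition (iii) on the enthalpy gives
  \<open>\<F>' > 1 - g - (\<xi> + B\<^sup>2) g' / 2 + \<tau>\<^sup>2 / \<xi>\<^sup>3 = 0\<close>.  For the existence of \<open>\<xi>\<^sub>*\<close>, positivity of the
  pressure yields \<open>\<F> < \<phi>\<close> on \<open>\<Omega>\<^sub>2\<close>, where \<open>\<phi> \<xi> = \<xi> + B\<^sup>2 - (D\<^sup>2 B\<^sup>2 + \<tau>\<^sup>2) / (2 \<xi>\<^sup>2) - E\<close>.
  With \<open>Q = f\<^sub>b / \<xi>\<^sup>2\<close>, the difference \<open>Q - 2 (2 \<xi> + B\<^sup>2) \<phi>\<close> is a concave quadratic in \<open>\<xi>\<close> whose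
  larger root is \<open>x\<^sub>0 = (\<Phi> - 2 (B\<^sup>2 - E)) / 3\<close>, and \<open>\<Psi> > 0\<close> says precisely that \<open>\<phi> x\<^sub>0 > 0\<close>;
  this forces \<open>\<phi> \<xi>\<^sub>b < 0\<close>.
\<close>

subsection \<open>Newton iteration with quasiconvex derivative\<close>

lemma newton_quasiconvex_derivative:
  fixes f f' :: "real \<Rightarrow> real" and x :: "nat \<Rightarrow> real"
  assumes der: "\<And>y. y > a \<Longrightarrow> (f has_real_derivative f' y) (at y)"
    and pos: "\<And>y. y > a \<Longrightarrow> f' y > 0"
    and quasiconvex: "\<And>u v w. a < u \<Longrightarrow> u \<le> v \<Longrightarrow> v \<le> w \<Longrightarrow> f' v \<le> max (f' u) (f' w)"
    and root: "f r = 0"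
    and start: "a < x 0" "x 0 \<le> r"
    and iter: "\<And>n. x (Suc n) = x n - f (x n) / f' (x n)"
  shows "x n > a" and "x \<longlonglongrightarrow> r"
proof -
  have mvt: "\<exists>c. u < c \<and> c < v \<and> f v - f u = (v - u) * f' c" if "a < u" "u < v" for u v
    using MVT2[OF that(2), of f f'] der that by (metis dual_order.strict_trans1 less_eq_real_def)
  have less: "f u < f v" if uv: "a < u" "u < v" for u v
  proof -
    obtain c where c: "u < c" "c < v" "f v - f u = (v - u) * f' c" using mvt[OF uv] by blast
    have "f' c > 0" using c uv pos by auto
    hence "f v - f u > 0" using uv c by simp
    thus ?thesis by simp
  qed
  have ra: "r > a" using start by simp
  have le0: "f y \<le> 0" if "a < y" "y \<le> r" for y using less[of y r] that root by (cases "y = r") auto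
  have ge0: "f y \<ge> 0" if "r \<le> y" for y using less[of r y] that root ra by (cases "y = r") auto
  \<comment> \<open>The derivative may jump, so the Newton formula cannot simply be passed to the
    limit. Instead quasiconvexity bounds \<open>f'\<close> on \<open>{u..v}\<close> by its endpoint
    values, whence \<open>f (x n)\<close> is dominated by a constant times the step length, which
    tends to 0.\<close>
  have limit_root: "x \<longlonglongrightarrow> r"
    if L: "x \<longlonglongrightarrow> L" and in_uv: "\<And>n. n \<ge> N \<Longrightarrow> u \<le> x n \<and> x n \<le> v" and u: "a < u" for L N u v
  proof -
    have La: "L > a" using LIMSEQ_le_const[OF L, of u] in_uv u by fastforce
    let ?C = "max (f' u) (f' v)"
    have fx: "(\<lambda>n. f (x n)) \<longlonglongrightarrow> f L"
      using isCont_tendsto_compose[OF DERIV_isCont[OF der[OF La]] L] .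
    have d: "(\<lambda>n. ?C * \<bar>x (Suc n) - x n\<bar>) \<longlonglongrightarrow> ?C * \<bar>L - L\<bar>"
      by (intro tendsto_intros L LIMSEQ_Suc)
    have "\<forall>\<^sub>F n in sequentially. norm (f (x n)) \<le> ?C * \<bar>x (Suc n) - x n\<bar>"
    proof (rule eventually_sequentiallyI[of N])
      fix n assume n: "N \<le> n"
      have p: "f' (x n) > 0" using in_uv[OF n] u pos by auto
      have "\<bar>f (x n)\<bar> = f' (x n) * \<bar>x (Suc n) - x n\<bar>" using p by (simp add: iter abs_divide)
      also have "\<dots> \<le> ?C * \<bar>x (Suc n) - x n\<bar>"
        using quasiconvex[OF u] in_uv[OF n] by (intro mult_right_mono) auto
      finally show "norm (f (x n)) \<le> ?C * \<bar>x (Suc n) - x n\<bar>" by simp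
    qed
    hence "(\<lambda>n. f (x n)) \<longlonglongrightarrow> 0" by (rule Lim_null_comparison) (use d in simp)
    hence "f L = 0" using fx LIMSEQ_unique by blast
    hence "L = r" using less[of L r] less[of r L] La ra root by (cases L r rule: linorder_cases) auto
    thus ?thesis using L by simp
  qed
  have up: "x n \<le> x (Suc n)" if "a < x n" "x n \<le> r" for n
    using le0[OF that] pos[OF that(1)] by (simp add: iter divide_le_0_iff)
  have "(\<forall>n. x n > a) \<and> x \<longlonglongrightarrow> r"
  proof (cases "\<forall>n. x n \<le> r")
    case True
    have x0: "x 0 \<le> x n" for n
    proof (induction n)
      case (Suc n) thus ?case using up[of n] True start by force
    qed simp
    hence xa: "x n > a" for n using start by (metis less_le_trans)
    have "incseq x" by (rule incseq_SucI) (use up xa True in blast)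
    then obtain L where "x \<longlonglongrightarrow> L" using incseq_convergent True by metis
    hence "x \<longlonglongrightarrow> r" using limit_root[of L 0 "x 0" r] x0 True start by blast
    thus ?thesis using xa by blast
  next
    case False
    \<comment> \<open>The first index beyond the root. It is positive because
      \<open>x 0 \<le> r\<close>, so the overshooting step starts at a predecessor \<open>k\<close>
      still to the left of \<open>r\<close>.\<close>
    define N where "N = (LEAST n. x n > r)"
    have N: "x N > r" unfolding N_def using False by (metis LeastI not_le)
    have before: "x n \<le> r" if "n < N" for n using that not_less_Least N_def not_le by metis
    obtain k where k: "N = Suc k" using N start by (cases N) auto
    have x0: "n < N \<Longrightarrow> x 0 \<le> x n" for n
    proof (induction n)
      case (Suc n) thus ?case using up[of n] before[of n] start by force
    qed simp
    have xk: "a < x k" "x k \<le> r" using x0[of k] before[of k] k start by auto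
    have fk: "f (x k) = f' (x k) * (x k - x N)"
      using pos[OF xk(1)] by (simp add: iter k)
    have "x k \<noteq> r" using fk root N pos[OF xk(1)] by auto
    hence xkr: "x k < r" using xk by simp
    obtain c where c: "x k < c" "c < r" "f r - f (x k) = (r - x k) * f' c" using mvt[OF xk(1) xkr] by blast
    txt \<open>Overshooting the root makes \<open>f'\<close> larger at some later \<open>c < r\<close>, and then quasiconvexity
      forces \<open>f'\<close> to be increasing from \<open>c\<close> on.\<close>
    have "(r - x k) * f' c = f' (x k) * (x N - x k)" using c root fk by (simp add: algebra_simps)
    also have "\<dots> > f' (x k) * (r - x k)" using N pos[OF xk(1)] by simp
    finally have gt: "f' c > f' (x k)" using xkr by (simp add: mult.commute)
    have incr: "f' y \<le> f' z" if "c \<le> y" "y \<le> z" for y z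
      using quasiconvex[OF xk(1), of c y] quasiconvex[OF xk(1), of y z] gt c that by force
    \<comment> \<open>Where \<open>f'\<close> increases, the mean slope between \<open>r\<close> and
      \<open>x n\<close> is at most \<open>f' (x n)\<close>. The tangent at \<open>x n\<close> is
      therefore at least as steep as the chord and meets the axis no further left than
      \<open>r\<close>.\<close>
    have newton_right: "r \<le> x (Suc n) \<and> x (Suc n) \<le> x n" if n: "r \<le> x n" for n
    proof
      have p: "f' (x n) > 0" using n ra pos by simp
      thus "x (Suc n) \<le> x n" using ge0[OF n] by (simp add: iter)
      show "r \<le> x (Suc n)"
      proof (cases "x n = r")
        case False
        then obtain d where d: "r < d" "d < x n" "f (x n) - f r = (x n - r) * f' d"
          using mvt[OF ra, of "x n"] n by auto
        have "f (x n) \<le> (x n - r) * f' (x n)"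
          using d root incr[of d "x n"] c n by (auto intro!: mult_left_mono)
        hence "f (x n) / f' (x n) \<le> x n - r" using p by (simp add: divide_le_eq)
        thus ?thesis by (simp add: iter)
      qed (simp add: iter root)
    qed
    have after: "r \<le> x n \<and> x n \<le> x N" if "N \<le> n" for n
      using that
    proof (induction n rule: dec_induct)
      case base thus ?case using N by simp
    next
      case (step n) thus ?case using newton_right[of n] by force
    qed
    have xa: "x n > a" for n
      using x0[of n] after[of n] start ra by (cases "n < N") auto
    have "decseq (\<lambda>n. x (n + N))" by (rule decseq_SucI) (use newton_right after in force)
    then obtain L where "(\<lambda>n. x (n + N)) \<longlonglongrightarrow> L"
      using decseq_convergent[of "\<lambda>n. x (n + N)" r] after by force
    hence "x \<longlonglongrightarrow> L" by (simp add: LIMSEQ_offset)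
    hence "x \<longlonglongrightarrow> r" using limit_root[of L N r "x N"] after ra by blast
    thus ?thesis using xa by blast
  qed
  thus "x n > a" and "x \<longlonglongrightarrow> r" by auto
qed

text \<open>A decreasing stretch bounds the middle value by the left one, an increasing stretch by
  the right one; for a valley the position of \<open>v\<close> relative to its bottom
  decides.\<close>

lemma mono_on_or_antimono_on_quasiconvex:
  fixes f :: "real \<Rightarrow> real"
  assumes "(mono_on {a<..} f \<or> antimono_on {a<..} f) \<or>
      (\<exists>c\<in>{a<..}. antimono_on {a<..c} f \<and> mono_on {c..} f)"
    and "a < u" "u \<le> v" "v \<le> w"
  shows "f v \<le> max (f u) (f w)"
proof -
  have "f v \<le> f u \<or> f v \<le> f w"
    using assms(1)
  proof (elim disjE bexE conjE)
    assume "mono_on {a<..} f"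
    from monotone_onD[OF this, of v w] show ?thesis using assms(2-4) by simp
  next
    assume "antimono_on {a<..} f"
    from monotone_onD[OF this, of u v] show ?thesis using assms(2-4) by simp
  next
    fix c assume c: "antimono_on {a<..c} f" "mono_on {c..} f"
    show ?thesis
    proof (cases "v \<le> c")
      case True
      thus ?thesis using monotone_onD[OF c(1), of u v] assms(2-4) by simp
    next
      case False
      thus ?thesis using monotone_onD[OF c(2), of v w] assms(2-4) by simp
    qed
  qed
  thus ?thesis by auto
qed

subsection \<open>The equation of state\<close>

text \<open>A linear map on the plane is determined by its values at the two unit vectors, and
  restriction to the coordinate lines identifies these with the partial derivatives occurring in
  condition (iii).\<close>

lemma eos_has_derivative:
  assumes "general_eos H" "\<rho> > 0" "p > 0"
  shows "((\<lambda>(\<rho>, p). H \<rho> p) has_derivative (\<lambda>(r, s). deriv (\<lambda>r. H r p) \<rho> * r + deriv (H \<rho>) p * s)) (at (\<rho>, p))"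
proof -
  let ?f = "\<lambda>(\<rho>, p). H \<rho> p"
  have op: "open ({0<..} \<times> {0<..} :: (real \<times> real) set)" by (intro open_Times) auto
  have "?f differentiable (at (\<rho>, p))"
    using assms op unfolding general_eos_def differentiable_on_def
    by (metis at_within_open greaterThan_iff mem_Sigma_iff)
  then obtain f' where f': "(?f has_derivative f') (at (\<rho>, p))"
    unfolding differentiable_def by blast
  interpret f': bounded_linear f' using f' by (rule has_derivative_bounded_linear)
  have "((\<lambda>r. (r, p)) has_derivative (\<lambda>r. (r, 0))) (at \<rho>)"
    by (intro has_derivative_Pair has_derivative_ident has_derivative_const)
  from has_derivative_compose[OF this f']
  have "((\<lambda>r. H r p) has_derivative (\<lambda>r. f' (r, 0))) (at \<rho>)" by simp
  moreover have "(\<lambda>r. f' (r, 0)) = (\<lambda>r. f' (1, 0) * r)"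
  proof
    fix r show "f' (r, 0) = f' (1, 0) * r" using f'.scaleR[of r "(1, 0)"] by (simp add: mult.commute)
  qed
  ultimately have 1: "deriv (\<lambda>r. H r p) \<rho> = f' (1, 0)"
    by (intro DERIV_imp_deriv) (simp add: has_field_derivative_def)
  have "((\<lambda>s. (\<rho>, s)) has_derivative (\<lambda>s. (0, s))) (at p)"
    by (intro has_derivative_Pair has_derivative_ident has_derivative_const)
  from has_derivative_compose[OF this f']
  have "(H \<rho> has_derivative (\<lambda>s. f' (0, s))) (at p)" by simp
  moreover have "(\<lambda>s. f' (0, s)) = (\<lambda>s. f' (0, 1) * s)"
  proof
    fix s show "f' (0, s) = f' (0, 1) * s" using f'.scaleR[of s "(0, 1)"] by (simp add: mult.commute)
  qed
  ultimately have 2: "deriv (H \<rho>) p = f' (0, 1)"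
    by (intro DERIV_imp_deriv) (simp add: has_field_derivative_def)
  have "f' = (\<lambda>(r, s). f' (1, 0) * r + f' (0, 1) * s)"
  proof
    fix z :: "real \<times> real"
    show "f' z = (case z of (r, s) \<Rightarrow> f' (1, 0) * r + f' (0, 1) * s)"
      using f'.add[of "(fst z, 0)" "(0, snd z)"] f'.scaleR[of "fst z" "(1, 0)"] f'.scaleR[of "snd z" "(0, 1)"]
      by (simp add: case_prod_unfold mult.commute)
  qed
  thus ?thesis using f' unfolding 1 2 by simp
qed

lemma eos_bound:
  assumes "general_eos H" "\<rho> > 0" "p > 0"
  shows "H \<rho> p \<ge> sqrt (1 + p\<^sup>2 / \<rho>\<^sup>2) + p / \<rho>" and "H \<rho> p > 1"
proof -
  show 1: "H \<rho> p \<ge> sqrt (1 + p\<^sup>2 / \<rho>\<^sup>2) + p / \<rho>" using assms by (simp add: general_eos_def)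
  have "sqrt (1 + p\<^sup>2 / \<rho>\<^sup>2) \<ge> 1" by simp
  moreover have "p / \<rho> > 0" using assms by simp
  ultimately show "H \<rho> p > 1" using 1 by linarith
qed

text \<open>The two inequalities of (iii) chain to a negative product whose first factor
  \<open>H \<rho> p\<close> is positive.\<close>

lemma eos_deriv_p_gt:
  assumes "general_eos H" "\<rho> > 0" "p > 0"
  shows "deriv (H \<rho>) p > 1 / \<rho>"
proof -
  have "H \<rho> p * (1 / \<rho> - deriv (H \<rho>) p) < 0"
    using assms unfolding general_eos_def by (meson less_trans)
  thus ?thesis using eos_bound(2)[OF assms] by (simp add: mult_less_0_iff)
qed

lemma eos_deriv_p_pos:
  assumes "general_eos H" "\<rho> > 0" "p > 0"
  shows "deriv (H \<rho>) p > 0"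
proof -
  have "0 < 1 / \<rho>" using assms by simp
  thus ?thesis using eos_deriv_p_gt[OF assms] by (rule less_trans)
qed

lemma eos_has_derivative_p:
  assumes "general_eos H" "\<rho> > 0" "p > 0"
  shows "(H \<rho> has_real_derivative deriv (H \<rho>) p) (at p)"
proof -
  have "((\<lambda>s. (\<rho>, s)) has_derivative (\<lambda>s. (0, s))) (at p)"
    by (intro has_derivative_Pair has_derivative_ident has_derivative_const)
  from has_derivative_compose[OF this eos_has_derivative[OF assms]]
  show ?thesis by (simp add: has_field_derivative_def)
qed

lemma eos_strict_mono:
  assumes "general_eos H" "\<rho> > 0" "0 < p" "p < q"
  shows "H \<rho> p < H \<rho> q"
proof (rule DERIV_pos_imp_increasing[OF assms(4)])
  fix x assume "p \<le> x" "x \<le> q"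
  hence "x > 0" using assms by simp
  moreover have "deriv (H \<rho>) x > 0"
    using eos_deriv_p_pos[OF assms(1,2)] calculation by blast
  ultimately show "\<exists>y. (H \<rho> has_real_derivative y) (at x) \<and> 0 < y"
    using eos_has_derivative_p[OF assms(1,2)] by blast
qed

lemma eos_less_iff:
  assumes "general_eos H" "\<rho> > 0" "p > 0" "q > 0"
  shows "H \<rho> p < H \<rho> q \<longleftrightarrow> p < q"
  using eos_strict_mono[OF assms(1-3), of q] eos_strict_mono[OF assms(1,2,4), of p]
  by (cases p q rule: linorder_cases) auto

section \<open>Inverting the enthalpy: existence, continuity and derivative of the pressure\<close>

lemma pressure_eqI:
  assumes "general_eos H" "\<rho> > 0" "p > 0" "H \<rho> p = h"
  shows "pressure H \<rho> h = p"
proof -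
  have "(THE p. p > 0 \<and> H \<rho> p = h) = p"
  proof (rule the_equality)
    fix q assume "q > 0 \<and> H \<rho> q = h"
    thus "q = p"
      using assms eos_less_iff[OF assms(1,2), of p q] eos_less_iff[OF assms(1,2), of q p]
      by (cases p q rule: linorder_cases) auto
  qed (use assms in simp)
  thus ?thesis using assms eos_bound(2)[OF assms(1-3)] by (simp add: pressure_def)
qed

text \<open>Intermediate value theorem for \<open>H \<rho>\<close>: near pressure 0 condition (iv)
  gives values below \<open>h\<close>, and at pressure \<open>\<rho> * h\<close> the summand
  \<open>p / \<rho>\<close> in (ii) already equals \<open>h\<close>.\<close>

lemma
  assumes eos: "general_eos H" and "\<rho> > 0" "h > 1"
  shows pressure_pos: "pressure H \<rho> h > 0" and eos_pressure: "H \<rho> (pressure H \<rho> h) = h"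
proof -
  have "(H \<rho> \<longlongrightarrow> 1) (at_right 0)" using assms by (simp add: general_eos_def)
  hence "\<forall>\<^sub>F p in at_right 0. H \<rho> p < h" using \<open>h > 1\<close> by (rule order_tendstoD)
  then obtain e where e: "e > 0" "\<And>p. 0 < p \<Longrightarrow> p < e \<Longrightarrow> H \<rho> p < h"
    unfolding eventually_at_right_field by auto
  define u where "u = min (e / 2) (\<rho> * h)"
  have u: "0 < u" "H \<rho> u < h" "u \<le> \<rho> * h" using e assms by (auto simp: u_def)
  have "\<rho> * h > 0" using assms by simp
  hence v: "h \<le> H \<rho> (\<rho> * h)"
    using eos_bound(1)[OF eos \<open>\<rho> > 0\<close>, of "\<rho> * h"] \<open>\<rho> > 0\<close>
      real_sqrt_ge_zero[of "1 + (\<rho> * h)\<^sup>2 / \<rho>\<^sup>2"] by (simp del: real_sqrt_ge_zero real_sqrt_ge_0_iff)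
  have "continuous_on {u..\<rho> * h} (H \<rho>)"
    using u by (intro continuous_at_imp_continuous_on ballI
        DERIV_isCont[OF eos_has_derivative_p[OF eos \<open>\<rho> > 0\<close>]]) auto
  then obtain p where "u \<le> p" "H \<rho> p = h"
    using IVT'[of "H \<rho>" u h "\<rho> * h"] u v by auto
  moreover have "p > 0" using u calculation by linarith
  ultimately have "p > 0" "H \<rho> p = h" "pressure H \<rho> h = p"
    using pressure_eqI[OF eos \<open>\<rho> > 0\<close>] by auto
  thus "pressure H \<rho> h > 0" "H \<rho> (pressure H \<rho> h) = h" by auto
qed

text \<open>With \<open>q = p / \<rho>\<close>, condition (ii) reads
  \<open>sqrt (1 + q\<^sup>2) \<le> h - q\<close>; after squaring, \<open>q\<^sup>2\<close> cancels
  and a linear bound on \<open>q\<close> remains. It controls the master function for large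
  arguments.\<close>

lemma pressure_le:
  assumes "general_eos H" "\<rho> > 0" "h > 1"
  shows "pressure H \<rho> h \<le> \<rho> * (h - 1 / h) / 2"
proof -
  define q where "q = pressure H \<rho> h / \<rho>"
  have "h \<ge> sqrt (1 + q\<^sup>2) + q"
    using eos_bound(1)[OF assms(1,2) pressure_pos[OF assms]] eos_pressure[OF assms]
    by (simp add: q_def power_divide)
  hence "sqrt (1 + q\<^sup>2) \<le> h - q" by simp
  hence "1 + q\<^sup>2 \<le> (h - q)\<^sup>2" by (rule sqrt_le_D)
  hence "q * (2 * h) \<le> h\<^sup>2 - 1" by (simp add: power2_eq_square algebra_simps)
  hence "q \<le> (h\<^sup>2 - 1) / (2 * h)" using \<open>h > 1\<close> by (simp add: pos_le_divide_eq)
  also have "\<dots> = (h - 1 / h) / 2" using \<open>h > 1\<close> by (simp add: field_simps power2_eq_square)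
  finally show ?thesis using \<open>\<rho> > 0\<close> by (simp add: q_def pos_divide_le_eq mult.commute)
qed

lemma eos_isCont_density:
  assumes "general_eos H" "\<rho> > 0" "p > 0"
  shows "isCont (\<lambda>r. H r p) \<rho>"
proof -
  have "((\<lambda>r. (r, p)) has_derivative (\<lambda>r. (r, 0))) (at \<rho>)"
    by (intro has_derivative_Pair has_derivative_ident has_derivative_const)
  from has_derivative_continuous[OF has_derivative_compose[OF this eos_has_derivative[OF assms]]]
  show ?thesis by simp
qed

text \<open>By monotonicity of \<open>H r\<close>, comparing the pressure with a fixed
  \<open>q > 0\<close> amounts to comparing \<open>y\<close> with \<open>H r q\<close>, and strict
  inequalities of the latter kind persist near \<open>(\<rho>, h)\<close>. The inverse derivative
  rule needs this continuity.\<close>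

lemma pressure_tendsto:
  assumes eos: "general_eos H" and "\<rho> > 0" "h > 1"
  shows "((\<lambda>(r, y). pressure H r y) \<longlongrightarrow> pressure H \<rho> h) (nhds (\<rho>, h))"
proof -
  define p where "p = pressure H \<rho> h"
  have p: "p > 0" "H \<rho> p = h" unfolding p_def using pressure_pos eos_pressure assms by auto
  have fst: "filterlim fst (nhds \<rho>) (nhds (\<rho>, h))" and snd: "filterlim snd (nhds h) (nhds (\<rho>, h))"
    by (auto simp: nhds_prod intro: filterlim_fst filterlim_snd)
  have r: "\<forall>\<^sub>F z in nhds (\<rho>, h). fst z > 0" and y: "\<forall>\<^sub>F z in nhds (\<rho>, h). snd z > 1"
    using order_tendstoD(1)[OF fst \<open>\<rho> > 0\<close>] order_tendstoD(1)[OF snd \<open>h > 1\<close>] by auto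
  have cont: "((\<lambda>z. snd z - H (fst z) q) \<longlongrightarrow> h - H \<rho> q) (nhds (\<rho>, h))" if "q > 0" for q
    using eos_isCont_density[OF eos \<open>\<rho> > 0\<close> that] fst snd
    by (intro tendsto_diff isCont_tendsto_compose[of _ "\<lambda>r. H r q"])
  show ?thesis unfolding p_def[symmetric]
  proof (rule order_tendstoI)
    fix q assume "q < p"
    \<comment> \<open>The given bound \<open>q\<close> may be non-positive, outside the domain of
      the equation of state; it is raised to a positive value still below \<open>p\<close>.\<close>
    define q' where "q' = max q (p / 2)"
    have q': "q \<le> q'" "0 < q'" "q' < p" using p \<open>q < p\<close> by (auto simp: q'_def)
    hence "0 < h - H \<rho> q'" using eos_strict_mono[OF eos \<open>\<rho> > 0\<close>] p by force
    from r y order_tendstoD(1)[OF cont[OF q'(2)] this]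
    show "\<forall>\<^sub>F z in nhds (\<rho>, h). q < (case z of (r, y) \<Rightarrow> pressure H r y)"
    proof eventually_elim
      case (elim z)
      hence "H (fst z) q' < H (fst z) (pressure H (fst z) (snd z))" using eos_pressure[OF eos] by simp
      hence "q' < pressure H (fst z) (snd z)"
        using eos_less_iff[OF eos] elim q' pressure_pos[OF eos] by blast
      thus ?case using q' by (simp add: case_prod_unfold)
    qed
  next
    fix q assume "p < q"
    hence q: "q > 0" and "h - H \<rho> q < 0" using eos_strict_mono[OF eos \<open>\<rho> > 0\<close>] p by force+
    from r y order_tendstoD(2)[OF cont[OF q] this(2)]
    show "\<forall>\<^sub>F z in nhds (\<rho>, h). (case z of (r, y) \<Rightarrow> pressure H r y) < q"
    proof eventually_elim
      case (elim z)
      hence "H (fst z) (pressure H (fst z) (snd z)) < H (fst z) q" using eos_pressure[OF eos] by simp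
      hence "pressure H (fst z) (snd z) < q"
        using eos_less_iff[OF eos] elim q pressure_pos[OF eos] by blast
      thus ?case by (simp add: case_prod_unfold)
    qed
  qed
qed

text \<open>Implicit differentiation: \<open>(r, y) \<mapsto> (r, pressure H r y)\<close> inverts
  \<open>(r, s) \<mapsto> (r, H r s)\<close>, whose derivative is triangular and invertible because
  the partial derivative in the pressure is positive. The second component is the claim.\<close>

lemma pressure_has_derivative:
  assumes eos: "general_eos H" and "\<rho> > 0" "h > 1"
  defines "p \<equiv> pressure H \<rho> h"
  shows "((\<lambda>(r, y). pressure H r y) has_derivative
    (\<lambda>(r, y). (y - deriv (\<lambda>r. H r p) \<rho> * r) / deriv (H \<rho>) p)) (at (\<rho>, h))"
proof -
  let ?f = "\<lambda>z. (fst z, H (fst z) (snd z))"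
  let ?g = "\<lambda>z. (fst z, pressure H (fst z) (snd z))"
  let ?a = "deriv (\<lambda>r. H r p) \<rho>" and ?b = "deriv (H \<rho>) p"
  have p: "p > 0" "H \<rho> p = h" unfolding p_def using pressure_pos eos_pressure assms by auto
  have b: "?b > 0" by (rule eos_deriv_p_pos[OF eos \<open>\<rho> > 0\<close> p(1)])
  have f: "(?f has_derivative (\<lambda>(r, s). (r, ?a * r + ?b * s))) (at (?g (\<rho>, h)))"
    using eos_has_derivative[OF eos \<open>\<rho> > 0\<close> p(1)]
    by (auto simp: case_prod_unfold p_def intro!: derivative_eq_intros)
  have lin: "bounded_linear (\<lambda>(r, y). (r, (y - ?a * r) / ?b))"
    unfolding case_prod_unfold
    by (intro bounded_linear_Pair bounded_linear_fst bounded_linear_compose[OF bounded_linear_divide]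
        bounded_linear_sub bounded_linear_snd bounded_linear_const_mult)
  have cont: "continuous (at (\<rho>, h)) ?g"
    using tendsto_mono[OF at_within_le_nhds pressure_tendsto[OF assms(1-3)]]
    unfolding continuous_at case_prod_unfold
    by (intro tendsto_Pair tendsto_fst tendsto_ident_at) simp
  have op: "open ({0<..} \<times> {1<..} :: (real \<times> real) set)" by (intro open_Times) auto
  have "(?g has_derivative (\<lambda>(r, y). (r, (y - ?a * r) / ?b))) (at (\<rho>, h))"
    by (rule has_derivative_inverse_basic[OF f lin _ cont op])
       (use b assms eos_pressure[OF eos] in \<open>auto simp: fun_eq_iff\<close>)
  from has_derivative_snd[OF this] show ?thesis by (simp add: case_prod_unfold)
qed

text \<open>With \<open>s\<close> the inverse Lorentz factor and \<open>d\<close> its derivative,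
  the left side is the derivative of the pressure along the curve \<open>\<rho> = D * s\<close>,
  \<open>h = x * s / D\<close>. Condition (iii) bounds the density term, cancelling
  \<open>x * d / D\<close>, and \<open>1 / \<rho> < deriv (H \<rho>) p\<close> bounds
  \<open>s / D\<close>. The resulting bound no longer involves the equation of state.\<close>

lemma pressure_along_bound:
  fixes H :: "real \<Rightarrow> real \<Rightarrow> real" and D s x d :: real
  assumes eos: "general_eos H" and pos: "D > 0" "s > 0" "x > 0" "d \<ge> 0"
    and "\<rho> = D * s" "h = x * s / D" "h > 1"
  defines "p \<equiv> pressure H \<rho> h"
  shows "((s / D + x * d / D) - deriv (\<lambda>r. H r p) \<rho> * (D * d)) / deriv (H \<rho>) p < s\<^sup>2 + x * s * d"
proof -
  let ?a = "deriv (\<lambda>r. H r p) \<rho>" and ?\<beta> = "deriv (H \<rho>) p"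
  have \<rho>: "\<rho> > 0" using assms by simp
  have p: "p > 0" "H \<rho> p = h" unfolding p_def using pressure_pos eos_pressure assms \<rho> by auto
  have \<beta>: "?\<beta> > 0" "?\<beta> > 1 / \<rho>" using eos_deriv_p_pos eos_deriv_p_gt eos \<rho> p by auto
  have "h * (1 / \<rho> - ?\<beta>) < ?a" using eos \<rho> p unfolding general_eos_def by blast
  hence "- ?a \<le> h * (?\<beta> - 1 / \<rho>)" by (simp add: algebra_simps)
  hence "- ?a * (D * d) \<le> h * (?\<beta> - 1 / \<rho>) * (D * d)" using pos by (intro mult_right_mono) auto
  also have "\<dots> = ?\<beta> * (x * s * d) - x * d / D"
    using pos by (simp add: \<open>h = _\<close> \<open>\<rho> = _\<close> field_simps)
  finally have "(s / D + x * d / D) - ?a * (D * d) \<le> s / D + ?\<beta> * (x * s * d)" by simp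
  moreover have "s / D < ?\<beta> * s\<^sup>2"
  proof -
    have "s / D = 1 / \<rho> * s\<^sup>2" using pos by (simp add: \<open>\<rho> = _\<close> power2_eq_square)
    also have "\<dots> < ?\<beta> * s\<^sup>2" using \<beta> pos by (intro mult_strict_right_mono) auto
    finally show ?thesis .
  qed
  ultimately have "(s / D + x * d / D) - ?a * (D * d) < ?\<beta> * (s\<^sup>2 + x * s * d)"
    by (simp add: algebra_simps)
  thus ?thesis using \<beta> by (simp add: pos_divide_less_eq mult.commute)
qed

subsection \<open>Admissible states and the cold energy\<close>

locale admissible_state =
  fixes U :: conservative
  assumes admissible: "U \<in> admissible"
begin

definition "D = dens U"
definition "b = (norm (mag U))\<^sup>2"
definition "M = (norm (mom U))\<^sup>2"
definition "T = (tau U)\<^sup>2"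
definition "E = ener U"
definition "K = D\<^sup>2 * b + T"

lemma D_pos: "D > 0" and b_nonneg: "b \<ge> 0" and M_nonneg: "M \<ge> 0" and T_nonneg: "T \<ge> 0"
  and K_nonneg: "K \<ge> 0"
  using admissible by (auto simp: admissible_def D_def b_def M_def T_def K_def)

lemma E_gt: "E > sqrt (D\<^sup>2 + M)"
  using admissible by (simp add: admissible_def E_def D_def M_def)

text \<open>The squared length of the numerator
  \<open>mom U + (tau U / \<xi>) *\<^sub>R mag U\<close> of the velocity.\<close>

definition "N \<xi> = M + (2 / \<xi> + b / \<xi>\<^sup>2) * T"

definition "g \<xi> = 1 - N \<xi> / (\<xi> + b)\<^sup>2"

lemma f_a_eq: "\<xi> > 0 \<Longrightarrow> f_a U \<xi> = \<xi>\<^sup>2 * (\<xi> + b)\<^sup>2 * g \<xi>"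
  using b_nonneg unfolding f_a_def g_def N_def b_def[symmetric] M_def[symmetric] T_def[symmetric]
  by (simp add: field_simps power2_eq_square add_nonneg_eq_0_iff)

lemma Omega1_iff: "\<xi> \<in> Omega1 U \<longleftrightarrow> \<xi> > 0 \<and> g \<xi> > 0"
proof (cases "\<xi> > 0")
  case True
  hence "\<xi>\<^sup>2 * (\<xi> + b)\<^sup>2 > 0" using b_nonneg by simp
  hence "f_a U \<xi> > 0 \<longleftrightarrow> g \<xi> > 0" unfolding f_a_eq[OF True]
    using zero_less_mult_iff[of "\<xi>\<^sup>2 * (\<xi> + b)\<^sup>2" "g \<xi>"] by linarith
  thus ?thesis using True by (simp add: Omega1_def)
qed (simp add: Omega1_def)

lemma norm_velocity_at: "\<xi> > 0 \<Longrightarrow> (norm (velocity_at U \<xi>))\<^sup>2 = 1 - g \<xi>"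
proof -
  assume x: "\<xi> > 0"
  have "(norm (mom U + (tau U / \<xi>) *\<^sub>R mag U))\<^sup>2 = N \<xi>"
    using x unfolding N_def M_def b_def T_def power2_norm_eq_inner tau_def
    by (simp add: inner_add_left inner_add_right inner_commute field_simps power2_eq_square)
  thus ?thesis
    by (simp add: velocity_at_def g_def b_def power_mult_distrib power_divide)
qed

lemma velocity_at_less_1:
  assumes "\<xi> \<in> Omega1 U"
  shows "norm (velocity_at U \<xi>) < 1"
  using norm_velocity_at[of \<xi>] assms power2_less_imp_less[of "norm (velocity_at U \<xi>)" 1]
  by (simp add: Omega1_iff)

lemma lorentz_eq:
  assumes "\<xi> \<in> Omega1 U"
  shows "lorentz U \<xi> = 1 / sqrt (g \<xi>)"
proof -
  have x: "\<xi> > 0" "g \<xi> > 0" using assms by (auto simp: Omega1_iff)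
  hence "\<xi> + b > 0" using b_nonneg by simp
  thus ?thesis
    using x by (simp add: lorentz_def f_a_eq real_sqrt_mult flip: b_def)
qed

lemma density_at_eq: "\<xi> \<in> Omega1 U \<Longrightarrow> density_at U \<xi> = D * sqrt (g \<xi>)"
  by (simp add: density_at_def lorentz_eq D_def)

lemma enthalpy_at_eq: "\<xi> \<in> Omega1 U \<Longrightarrow> enthalpy_at U \<xi> = \<xi> * sqrt (g \<xi>) / D"
  by (simp add: enthalpy_at_def lorentz_eq D_def)

lemma master_fun_eq:
  assumes "\<xi> \<in> Omega1 U"
  shows "master_fun H U \<xi> = \<xi> - pressure H (D * sqrt (g \<xi>)) (\<xi> * sqrt (g \<xi>) / D)
    - 1 / 2 * (b * g \<xi> + T / \<xi>\<^sup>2) + b - E"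
  using assms Omega1_iff[of \<xi>]
  by (simp add: master_fun_def pressure_at_def density_at_eq enthalpy_at_eq lorentz_eq power_divide
      b_def T_def E_def)

section \<open>The rescaled \<open>f_b\<close> and the region where the enthalpy exceeds 1\<close>

definition "Q \<xi> = (\<xi> + b)\<^sup>2 - (D\<^sup>2 + M) - (2 / \<xi> + b / \<xi>\<^sup>2) * K"

lemma Q_eq: "\<xi> > 0 \<Longrightarrow> \<xi>\<^sup>2 * Q \<xi> = (\<xi> + b)\<^sup>2 * (\<xi>\<^sup>2 * g \<xi> - D\<^sup>2)"
  using b_nonneg unfolding g_def Q_def N_def K_def
  by (simp add: field_simps power2_eq_square add_nonneg_eq_0_iff)

lemma f_b_eq: "\<xi> > 0 \<Longrightarrow> f_b U \<xi> = \<xi>\<^sup>2 * Q \<xi>"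
  unfolding Q_eq by (simp add: f_b_def f_a_eq algebra_simps flip: D_def b_def)

text \<open>Both squares in \<open>Q_eq\<close> are positive. Where \<open>g\<close> is positive,
  \<open>D\<^sup>2 < \<xi>\<^sup>2 * g \<xi>\<close> is the squared form of the requirement that the
  enthalpy \<open>\<xi> * sqrt (g \<xi>) / D\<close> exceed 1.\<close>

lemma Q_pos_iff: "\<xi> > 0 \<Longrightarrow> Q \<xi> > 0 \<longleftrightarrow> \<xi>\<^sup>2 * g \<xi> > D\<^sup>2"
  and Q_zero_iff: "\<xi> > 0 \<Longrightarrow> Q \<xi> = 0 \<longleftrightarrow> \<xi>\<^sup>2 * g \<xi> = D\<^sup>2"
proof -
  assume x: "\<xi> > 0"
  hence "\<xi>\<^sup>2 > 0" "(\<xi> + b)\<^sup>2 > 0" using b_nonneg by auto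
  thus "Q \<xi> > 0 \<longleftrightarrow> \<xi>\<^sup>2 * g \<xi> > D\<^sup>2" "Q \<xi> = 0 \<longleftrightarrow> \<xi>\<^sup>2 * g \<xi> = D\<^sup>2"
    using Q_eq[OF x] zero_less_mult_iff[of "\<xi>\<^sup>2" "Q \<xi>"]
      zero_less_mult_iff[of "(\<xi> + b)\<^sup>2" "\<xi>\<^sup>2 * g \<xi> - D\<^sup>2"] by (auto simp del: zero_less_power2)
qed

text \<open>The square increases, while \<open>K \<ge> 0\<close> multiplies a decreasing function
  and is subtracted.\<close>

lemma Q_less:
  assumes "0 < x" "x < y"
  shows "Q x < Q y"
proof -
  have "(x + b)\<^sup>2 < (y + b)\<^sup>2" using assms b_nonneg by (intro power_strict_mono) auto
  moreover have "2 / y + b / y\<^sup>2 \<le> 2 / x + b / x\<^sup>2"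
    using assms b_nonneg by (intro add_mono divide_left_mono power_mono) auto
  hence "(2 / y + b / y\<^sup>2) * K \<le> (2 / x + b / x\<^sup>2) * K" using K_nonneg by (rule mult_right_mono)
  ultimately show ?thesis unfolding Q_def by linarith
qed

text \<open>Here \<open>\<xi>\<^sup>2 * g \<xi>\<close> is at least \<open>D\<^sup>2 > 0\<close>.
  Hence positive roots of \<open>Q\<close> lie in \<open>Omega1 U\<close> automatically.\<close>

lemma g_pos: "0 < \<xi> \<Longrightarrow> Q \<xi> \<ge> 0 \<Longrightarrow> g \<xi> > 0"
proof -
  assume x: "0 < \<xi>" "Q \<xi> \<ge> 0"
  hence "\<xi>\<^sup>2 * g \<xi> \<ge> D\<^sup>2" using Q_pos_iff[of \<xi>] Q_zero_iff[of \<xi>] by linarith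
  hence "\<xi>\<^sup>2 * g \<xi> > 0" using D_pos by (smt (verit) zero_less_power)
  thus ?thesis using x by (simp add: zero_less_mult_iff)
qed

lemma g_le_1: "\<xi> > 0 \<Longrightarrow> g \<xi> \<le> 1"
  using b_nonneg M_nonneg T_nonneg by (simp add: g_def N_def)

text \<open>At \<open>xi_b U\<close>, where \<open>g \<xi> = D\<^sup>2 / \<xi>\<^sup>2\<close>, this is the master function with zero pressure.\<close>

definition "\<phi> \<xi> = \<xi> + b - K / (2 * \<xi>\<^sup>2) - E"

section \<open>Consequences of \<open>Psi U > 0\<close> for the root of \<open>Q\<close>\<close>

lemma E_square_gt: "E\<^sup>2 > D\<^sup>2 + M" and E_pos: "E > 0"
proof -
  have "0 \<le> sqrt (D\<^sup>2 + M)" using M_nonneg by simp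
  thus "E > 0" using E_gt by linarith
  have "(sqrt (D\<^sup>2 + M))\<^sup>2 < E\<^sup>2" using E_gt M_nonneg by (intro power_strict_mono) auto
  thus "E\<^sup>2 > D\<^sup>2 + M" using M_nonneg by simp
qed

text \<open>The factor \<open>2 * (2 * \<xi> + b)\<close> is the one for which the terms with
  \<open>K\<close> cancel. A quadratic with leading coefficient -3 remains, and completing the
  square produces \<open>Phi U\<close>.\<close>

lemma Q_\<phi>:
  assumes "\<xi> > 0"
  shows "Q \<xi> - 2 * (2 * \<xi> + b) * \<phi> \<xi> = ((Phi U)\<^sup>2 - (3 * \<xi> + 2 * (b - E))\<^sup>2) / 3"
proof -
  have P: "(Phi U)\<^sup>2 = (b - E)\<^sup>2 + 3 * (E\<^sup>2 - D\<^sup>2 - M)"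
    using E_square_gt by (simp add: Phi_def b_def E_def D_def M_def)
  show ?thesis unfolding P using assms
    by (simp add: Q_def \<phi>_def field_simps power2_eq_square)
qed

lemma Phi_gt: "Phi U > \<bar>b - E\<bar>"
proof -
  have "sqrt ((b - E)\<^sup>2) < Phi U"
    using E_square_gt unfolding Phi_def b_def E_def D_def M_def by (intro real_sqrt_less_mono) auto
  thus ?thesis by simp
qed

definition "x\<^sub>0 = (Phi U - 2 * (b - E)) / 3"

lemma x0_eq: "3 * x\<^sub>0 = Phi U - 2 * (b - E)"
  by (simp add: x\<^sub>0_def)

lemma x0_pos: "x\<^sub>0 > 0" and \<phi>_x0: "\<phi> x\<^sub>0 > 0"
proof -
  \<comment> \<open>In terms of \<open>x\<^sub>0\<close>, the first factor in \<open>Psi U\<close>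
    is \<open>3 * x\<^sub>0\<close> and the radicand of the second is
    \<open>3 * (x\<^sub>0 + b - E)\<close>, so squaring \<open>Psi U > 0\<close> gives the sign of
    \<open>\<phi>\<close> at \<open>x\<^sub>0\<close>.\<close>
  define y where "y = sqrt (Phi U + b - E)"
  have y: "y > 0" "y\<^sup>2 = 3 * (x\<^sub>0 + b - E)"
    using Phi_gt x0_eq by (auto simp: y_def)
  have Psi: "sqrt (27 / 2 * K) < 3 * x\<^sub>0 * y"
    using admissible unfolding admissible_def Psi_def y_def K_def x0_eq D_def b_def T_def E_def
    by simp
  moreover have "0 \<le> sqrt (27 / 2 * K)" using K_nonneg by simp
  ultimately have "0 < 3 * x\<^sub>0 * y" by linarith
  thus x0: "x\<^sub>0 > 0" using y by (simp add: zero_less_mult_iff)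
  have "(sqrt (27 / 2 * K))\<^sup>2 < (3 * x\<^sub>0 * y)\<^sup>2"
    using Psi K_nonneg by (intro power_strict_mono) auto
  hence "27 / 2 * K < 9 * x\<^sub>0\<^sup>2 * (3 * (x\<^sub>0 + b - E))"
    using K_nonneg by (simp add: power_mult_distrib y(2))
  hence "K / (2 * x\<^sub>0\<^sup>2) < x\<^sub>0 + b - E" using x0 by (simp add: field_simps)
  thus "\<phi> x\<^sub>0 > 0" by (simp add: \<phi>_def)
qed

text \<open>The right side of \<open>Q_\<phi>\<close> vanishes at \<open>x\<^sub>0\<close>, so
  \<open>Q\<close> inherits the sign of \<open>\<phi>\<close> there. This makes
  \<open>x\<^sub>0\<close> an upper bound for the root of \<open>Q\<close>.\<close>

lemma Q_x0: "Q x\<^sub>0 > 0"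
proof -
  have "Q x\<^sub>0 = 2 * (2 * x\<^sub>0 + b) * \<phi> x\<^sub>0"
    using Q_\<phi>[OF x0_pos] unfolding x0_eq by simp
  thus ?thesis using x0_pos \<phi>_x0 b_nonneg by simp
qed

lemma ex1_Q_root: "\<exists>!\<xi>. \<xi> > 0 \<and> Q \<xi> = 0"
proof -
  \<comment> \<open>Since \<open>g\<close> is at most 1, \<open>\<xi>\<^sup>2 * g \<xi>\<close>
    stays below \<open>D\<^sup>2\<close> for \<open>\<xi> < D\<close>; the point
    \<open>D / 2\<close> serves as the left end for the intermediate value theorem, with
    \<open>x\<^sub>0\<close> as the right end.\<close>
  have "D / 2 * (D / 2) * g (D / 2) \<le> D / 2 * (D / 2) * 1"
    using g_le_1[of "D / 2"] D_pos by (intro mult_left_mono) auto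
  hence "\<not> (D / 2)\<^sup>2 * g (D / 2) \<ge> D\<^sup>2" using D_pos by (simp add: power2_eq_square)
  hence neg: "Q (D / 2) < 0" using Q_pos_iff[of "D / 2"] Q_zero_iff[of "D / 2"] D_pos by linarith
  hence le: "D / 2 \<le> x\<^sub>0" using Q_less[of x\<^sub>0 "D / 2"] Q_x0 x0_pos by force
  have "continuous_on {D / 2..x\<^sub>0} Q"
    unfolding Q_def using D_pos by (intro continuous_intros) auto
  then obtain r where "D / 2 \<le> r" "Q r = 0"
    using IVT'[of Q "D / 2" 0 x\<^sub>0] neg Q_x0 le by auto
  moreover have "x = y" if "x > 0 \<and> Q x = 0" "y > 0 \<and> Q y = 0" for x y
    using Q_less[of x y] Q_less[of y x] that by (cases x y rule: linorder_cases) auto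
  ultimately show ?thesis using D_pos by (metis half_gt_zero less_le_trans)
qed

lemma xi_b_pos: "xi_b U > 0" and Q_xi_b: "Q (xi_b U) = 0"
proof -
  have iff: "\<xi> \<in> Omega1 U \<and> f_b U \<xi> = 0 \<longleftrightarrow> \<xi> > 0 \<and> Q \<xi> = 0" for \<xi>
    using g_pos[of \<xi>] f_b_eq[of \<xi>] by (auto simp: Omega1_iff)
  show "xi_b U > 0" "Q (xi_b U) = 0"
    using theI'[OF ex1_Q_root] unfolding xi_b_def iff by auto
qed

text \<open>By \<open>Q_\<phi>\<close>, \<open>\<phi> \<ge> 0\<close> at the root of \<open>Q\<close> would place it outside the two roots of a
  concave quadratic, the larger of which is \<open>x\<^sub>0\<close>; below the smaller one \<open>\<phi>\<close> is negative.\<close>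

lemma \<phi>_xi_b: "\<phi> (xi_b U) < 0"
proof (rule ccontr)
  let ?r = "xi_b U" and ?c = "b - E"
  assume "\<not> \<phi> ?r < 0"
  hence ge: "\<phi> ?r \<ge> 0" by simp
  hence "0 \<le> 2 * (2 * ?r + b) * \<phi> ?r" using xi_b_pos b_nonneg by simp
  hence "(Phi U)\<^sup>2 \<le> (3 * ?r + 2 * ?c)\<^sup>2" using Q_\<phi>[OF xi_b_pos] Q_xi_b by simp
  hence "Phi U \<le> \<bar>3 * ?r + 2 * ?c\<bar>" using Phi_gt abs_le_square_iff[of "Phi U" "3 * ?r + 2 * ?c"] by simp
  moreover have "?r < x\<^sub>0" using Q_less[of x\<^sub>0 ?r] Q_x0 Q_xi_b x0_pos by (cases x\<^sub>0 ?r rule: linorder_cases) auto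
  hence "3 * ?r + 2 * ?c < Phi U" using x0_eq by linarith
  ultimately have "3 * ?r + 2 * ?c \<le> - Phi U" by linarith
  moreover have "?c < Phi U" using abs_ge_self Phi_gt by (rule le_less_trans)
  ultimately have "?r + ?c < 0" by argo
  moreover have "0 \<le> K / (2 * ?r\<^sup>2)" using K_nonneg by simp
  ultimately show False using ge unfolding \<phi>_def by linarith
qed

lemma Omega2D:
  assumes "\<xi> > xi_b U"
  shows "\<xi> > 0" "g \<xi> > 0" "D\<^sup>2 < \<xi>\<^sup>2 * g \<xi>" "\<xi> * sqrt (g \<xi>) / D > 1" "\<xi> \<in> Omega1 U"
proof -
  show x: "\<xi> > 0" using assms xi_b_pos by simp
  have Q: "Q \<xi> > 0" using Q_less[OF xi_b_pos assms] Q_xi_b by simp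
  show g: "g \<xi> > 0" using g_pos x Q by simp
  show gt: "D\<^sup>2 < \<xi>\<^sup>2 * g \<xi>" using Q_pos_iff x Q by simp
  have "D\<^sup>2 < (\<xi> * sqrt (g \<xi>))\<^sup>2" using gt g by (simp add: power_mult_distrib)
  hence "D < \<xi> * sqrt (g \<xi>)" by (rule power2_less_imp_less) (use x g in simp)
  thus "\<xi> * sqrt (g \<xi>) / D > 1" using D_pos by simp
  show "\<xi> \<in> Omega1 U" using x g by (simp add: Omega1_iff)
qed

section \<open>The derivative of \<open>g\<close>\<close>

definition "N' \<xi> = - (2 / \<xi>\<^sup>2 + 2 * b / \<xi> ^ 3) * T"

definition "g' \<xi> = 2 * N \<xi> / (\<xi> + b) ^ 3 - N' \<xi> / (\<xi> + b)\<^sup>2"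

lemma g_has_derivative:
  assumes "\<xi> > 0"
  shows "(g has_real_derivative g' \<xi>) (at \<xi>)"
proof -
  have N: "(N has_real_derivative N' \<xi>) (at \<xi>)"
    unfolding N_def N'_def using assms
    by (auto intro!: derivative_eq_intros simp: field_simps power2_eq_square power3_eq_cube)
  define w where "w = \<xi> + b"
  have w: "w > 0" using assms b_nonneg by (simp add: w_def)
  have "(g has_real_derivative 0 - (N' \<xi> * w\<^sup>2 - N \<xi> * (2 * w)) / (w\<^sup>2 * w\<^sup>2)) (at \<xi>)"
    unfolding g_def w_def
    by (rule derivative_eq_intros N refl | use w in \<open>simp add: w_def\<close>)+
  also have "0 - (N' \<xi> * w\<^sup>2 - N \<xi> * (2 * w)) / (w\<^sup>2 * w\<^sup>2) = g' \<xi>"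
    using w unfolding g'_def w_def[symmetric]
    by (simp add: field_simps power2_eq_square power3_eq_cube)
  finally show ?thesis .
qed

lemma g'_nonneg: "\<xi> > 0 \<Longrightarrow> g' \<xi> \<ge> 0"
proof -
  assume x: "\<xi> > 0"
  hence "2 / \<xi>\<^sup>2 + 2 * b / \<xi> ^ 3 \<ge> 0" using b_nonneg by simp
  hence "N' \<xi> \<le> 0" using T_nonneg unfolding N'_def by (simp add: mult_nonpos_nonneg)
  hence "N' \<xi> / (\<xi> + b)\<^sup>2 \<le> 0" by (simp add: divide_nonpos_nonneg)
  moreover have "2 * N \<xi> / (\<xi> + b) ^ 3 \<ge> 0"
    using x b_nonneg M_nonneg T_nonneg by (simp add: N_def)
  ultimately show ?thesis by (simp add: g'_def)
qed

text \<open>The terms with \<open>N\<close> cancel, and \<open>N'\<close> contributes exactly the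
  negative of the term with \<open>T\<close>. The left side is what remains of the derivative of the
  master function once \<open>pressure_along_bound\<close> has replaced the pressure term, so the
  strictness of that bound yields positivity.\<close>

lemma g'_identity: "\<xi> > 0 \<Longrightarrow> 1 - g \<xi> - \<xi> * g' \<xi> / 2 - b * g' \<xi> / 2 + T / \<xi> ^ 3 = 0"
proof -
  assume x: "\<xi> > 0"
  hence p: "\<xi> + b > 0" using b_nonneg by simp
  have "1 - g \<xi> - (\<xi> + b) * g' \<xi> / 2 = N' \<xi> / (2 * (\<xi> + b))"
  proof -
    have "n / w\<^sup>2 - w * (2 * n / w ^ 3 - n' / w\<^sup>2) / 2 = n' / (2 * w)" if "w > 0" for n n' w :: real
      using that by (simp add: field_simps power2_eq_square power3_eq_cube)
    from this[OF p] show ?thesis by (simp add: g_def g'_def)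
  qed
  also have "N' \<xi> = - 2 * (\<xi> + b) * (T / \<xi> ^ 3)"
    using x by (simp add: N'_def field_simps power2_eq_square power3_eq_cube)
  also have "\<dots> / (2 * (\<xi> + b)) = - (T / \<xi> ^ 3)"
  proof -
    have "- 2 * w * y / (2 * w) = - y" if "w > 0" for w y :: real using that by simp
    from this[OF p] show ?thesis .
  qed
  finally show ?thesis by (simp add: algebra_simps add_divide_distrib)
qed

subsection \<open>The master function\<close>

lemma master_fun_has_pos_derivative:
  assumes eos: "general_eos H" and x: "\<xi> > xi_b U"
  shows "\<exists>F'>0. (master_fun H U has_real_derivative F') (at \<xi>)"
proof -
  define s where "s = sqrt (g \<xi>)"
  define d where "d = g' \<xi> / (2 * s)"
  define \<rho> where "\<rho> = D * s"
  define h where "h = \<xi> * s / D"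
  define p where "p = pressure H \<rho> h"
  define F' where "F' = 1 - ((s / D + \<xi> * d / D) - deriv (\<lambda>r. H r p) \<rho> * (D * d)) / deriv (H \<rho>) p
    - 1 / 2 * (b * g' \<xi> - 2 * T / \<xi> ^ 3)"
  note x' = Omega2D[OF x]
  have s: "s > 0" "s\<^sup>2 = g \<xi>" using x' by (auto simp: s_def)
  have \<rho>: "\<rho> > 0" and h: "h > 1" using x' s D_pos by (auto simp: \<rho>_def h_def s_def)
  have d: "d \<ge> 0" "2 * s * d = g' \<xi>" using s g'_nonneg x' by (auto simp: d_def)
  have ds: "((\<lambda>y. sqrt (g y)) has_real_derivative d) (at \<xi>)"
    using DERIV_chain2[OF DERIV_real_sqrt[OF x'(2)] g_has_derivative[OF x'(1)]]
    by (simp add: d_def s_def field_simps)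
  have d\<rho>: "((\<lambda>y. D * sqrt (g y)) has_derivative (\<lambda>t. D * d * t)) (at \<xi>)"
    using DERIV_cmult[OF ds, of D] by (simp add: has_field_derivative_def)
  have "((\<lambda>y. y * sqrt (g y)) has_real_derivative s + \<xi> * d) (at \<xi>)"
    using DERIV_mult[OF DERIV_ident ds] by (simp add: s_def algebra_simps)
  hence "((\<lambda>y. y * sqrt (g y) / D) has_real_derivative (s + \<xi> * d) / D) (at \<xi>)"
    by (rule DERIV_cdivide)
  hence dh: "((\<lambda>y. y * sqrt (g y) / D) has_derivative (\<lambda>t. (s + \<xi> * d) / D * t)) (at \<xi>)"
    by (simp only: has_field_derivative_def)
  have "((\<lambda>(r, y). pressure H r y) has_derivative
    (\<lambda>(r, y). (y - deriv (\<lambda>r. H r p) \<rho> * r) / deriv (H \<rho>) p)) (at (D * sqrt (g \<xi>), \<xi> * sqrt (g \<xi>) / D))"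
    using pressure_has_derivative[OF eos \<rho> h] by (simp add: p_def \<rho>_def h_def s_def)
  from has_derivative_compose[OF has_derivative_Pair[OF d\<rho> dh] this]
  have dp: "((\<lambda>y. pressure H (D * sqrt (g y)) (y * sqrt (g y) / D)) has_real_derivative
    ((s / D + \<xi> * d / D) - deriv (\<lambda>r. H r p) \<rho> * (D * d)) / deriv (H \<rho>) p) (at \<xi>)"
    unfolding has_field_derivative_def prod.case
    by (rule has_derivative_eq_rhs) (simp add: fun_eq_iff diff_divide_distrib add_divide_distrib algebra_simps)
  have dT: "((\<lambda>y. T / y\<^sup>2) has_real_derivative - 2 * T / \<xi> ^ 3) (at \<xi>)"
    using x'(1) by (auto intro!: derivative_eq_intros simp: field_simps power2_eq_square power3_eq_cube)
  have dF: "((\<lambda>y. y - pressure H (D * sqrt (g y)) (y * sqrt (g y) / D) - 1 / 2 * (b * g y + T / y\<^sup>2) + b - E)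
    has_real_derivative F') (at \<xi>)"
    unfolding F'_def
    by (rule derivative_eq_intros dp dT g_has_derivative[OF x'(1)] refl | simp)+
  \<comment> \<open>The closed form agrees with the master function on the open set right of
    \<open>xi_b U\<close>, hence near \<open>\<xi>\<close>, which suffices to transfer the
    derivative.\<close>
  have "\<forall>\<^sub>F y in nhds \<xi>. y \<in> {xi_b U<..}"
    using x by (intro eventually_nhds_in_open) auto
  hence "\<forall>\<^sub>F y in nhds \<xi>. y - pressure H (D * sqrt (g y)) (y * sqrt (g y) / D)
    - 1 / 2 * (b * g y + T / y\<^sup>2) + b - E = master_fun H U y"
    by eventually_elim (simp add: master_fun_eq Omega2D)
  from iffD1[OF DERIV_cong_ev[OF refl this refl] dF]
  have "(master_fun H U has_real_derivative F') (at \<xi>)" .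
  moreover have "F' > 0"
  proof -
    have "((s / D + \<xi> * d / D) - deriv (\<lambda>r. H r p) \<rho> * (D * d)) / deriv (H \<rho>) p < s\<^sup>2 + \<xi> * s * d"
      unfolding p_def
      by (rule pressure_along_bound[OF eos D_pos s(1) x'(1) d(1) \<rho>_def h_def h])
    also have "\<dots> = g \<xi> + \<xi> * g' \<xi> / 2" by (simp flip: d(2) s(2))
    finally show ?thesis using g'_identity[OF x'(1)] by (simp add: F'_def algebra_simps)
  qed
  ultimately show ?thesis by blast
qed

lemma master_fun_DERIV:
  assumes "general_eos H" "\<xi> > xi_b U"
  shows "(master_fun H U has_real_derivative deriv (master_fun H U) \<xi>) (at \<xi>)"
    and "deriv (master_fun H U) \<xi> > 0"
  using master_fun_has_pos_derivative[OF assms] by (auto dest: DERIV_imp_deriv)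

lemma pressure_at_pos:
  assumes "general_eos H" "\<xi> > xi_b U"
  shows "pressure_at H U \<xi> > 0"
  using Omega2D[OF assms(2)] D_pos assms(1)
  by (simp add: pressure_at_def density_at_eq enthalpy_at_eq pressure_pos)

text \<open>Dropping the positive pressure makes the inequality strict, and
  \<open>g \<xi> \<ge> D\<^sup>2 / \<xi>\<^sup>2\<close> turns the magnetic terms into
  \<open>K\<close>.\<close>

lemma master_fun_less_\<phi>:
  assumes eos: "general_eos H" and x: "\<xi> > xi_b U"
  shows "master_fun H U \<xi> < \<phi> \<xi>"
proof -
  note x' = Omega2D[OF x]
  have "D\<^sup>2 / \<xi>\<^sup>2 \<le> g \<xi>" using x' by (simp add: pos_divide_le_eq mult.commute)
  hence "b * (D\<^sup>2 / \<xi>\<^sup>2) \<le> b * g \<xi>" using b_nonneg by (rule mult_left_mono)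
  moreover have "K / (2 * \<xi>\<^sup>2) = 1 / 2 * (b * (D\<^sup>2 / \<xi>\<^sup>2) + T / \<xi>\<^sup>2)"
    by (simp add: K_def add_divide_distrib mult.commute)
  moreover have "pressure H (D * sqrt (g \<xi>)) (\<xi> * sqrt (g \<xi>) / D) > 0"
    using pressure_pos[OF eos] x' D_pos by simp
  ultimately show ?thesis unfolding master_fun_eq[OF x'(5)] \<phi>_def by argo
qed

text \<open>By \<open>pressure_le\<close> the pressure is at most half of density times enthalpy,
  that is \<open>\<xi> * g \<xi> / 2\<close>, and \<open>g \<xi> \<le> 1\<close>. So at least half
  of the linear growth survives.\<close>

lemma master_fun_ge:
  assumes eos: "general_eos H" and x: "\<xi> > xi_b U"
  shows "master_fun H U \<xi> \<ge> \<xi> / 2 - T / (2 * \<xi>\<^sup>2) - E"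
proof -
  note x' = Omega2D[OF x]
  let ?s = "sqrt (g \<xi>)"
  have s: "?s > 0" "?s * ?s = g \<xi>" using x' by auto
  have "pressure H (D * ?s) (\<xi> * ?s / D) \<le> D * ?s * (\<xi> * ?s / D - 1 / (\<xi> * ?s / D)) / 2"
    using s D_pos x' by (intro pressure_le[OF eos]) auto
  also have "\<dots> \<le> D * ?s * (\<xi> * ?s / D) / 2"
    using s D_pos x' by (intro divide_right_mono mult_left_mono) auto
  also have "\<dots> = \<xi> * (?s * ?s) / 2" using D_pos by (simp add: field_simps del: real_sqrt_mult_self)
  also have "\<dots> = \<xi> * g \<xi> / 2" by (simp only: s(2))
  also have "\<dots> \<le> \<xi> / 2" using g_le_1[OF x'(1)] x'(1) by (simp add: mult_le_cancel_left1)
  finally have "pressure H (D * ?s) (\<xi> * ?s / D) \<le> \<xi> / 2" .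
  moreover have "b * g \<xi> \<le> b" using g_le_1[OF x'(1)] b_nonneg by (simp add: mult_left_le)
  moreover have "T / (2 * \<xi>\<^sup>2) = 1 / 2 * (T / \<xi>\<^sup>2)" by simp
  ultimately show ?thesis unfolding master_fun_eq[OF x'(5)] using b_nonneg by argo
qed

lemma master_fun_strict_mono:
  assumes "general_eos H" "xi_b U < x" "x < y"
  shows "master_fun H U x < master_fun H U y"
proof (rule DERIV_pos_imp_increasing[OF assms(3)])
  fix z assume "x \<le> z" "z \<le> y"
  thus "\<exists>F'. (master_fun H U has_real_derivative F') (at z) \<and> 0 < F'"
    using master_fun_has_pos_derivative[OF assms(1)] assms(2) by (meson less_le_trans)
qed

lemma ex1_master_fun_root:
  assumes eos: "general_eos H"
  shows "\<exists>!\<xi>. \<xi> \<in> Omega2 U \<and> master_fun H U \<xi> = 0"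
proof -
  let ?F = "master_fun H U"
  \<comment> \<open>Continuity is used for \<open>\<phi>\<close> rather than for the master function
    at the boundary point: \<open>\<phi>\<close> stays negative slightly to the right of
    \<open>xi_b U\<close>, and the master function lies below it there.\<close>
  have "isCont \<phi> (xi_b U)"
    unfolding \<phi>_def using xi_b_pos by (intro continuous_intros) auto
  hence "\<phi> \<midarrow>xi_b U\<rightarrow> \<phi> (xi_b U)" by (simp add: isCont_def)
  hence "(\<phi> \<longlongrightarrow> \<phi> (xi_b U)) (at_right (xi_b U))" by (rule filterlim_at_split[THEN iffD1, THEN conjunct2])
  from order_tendstoD(2)[OF this \<phi>_xi_b] obtain c where c: "c > xi_b U" "\<forall>y>xi_b U. y < c \<longrightarrow> \<phi> y < 0"
    unfolding eventually_at_right_field by blast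
  then obtain u where u: "xi_b U < u" "u < c" using dense by blast
  hence Fu: "?F u < 0" using master_fun_less_\<phi>[OF eos u(1)] c(2) by force
  \<comment> \<open>From \<open>v \<ge> 1\<close> the term with \<open>T\<close> in
    \<open>master_fun_ge\<close> is at most \<open>T / 2\<close>; then
    \<open>v \<ge> 1 + T + 2 * E\<close> leaves a lower bound of at least 1/2.\<close>
  define v where "v = max u (1 + T + 2 * E)"
  have v: "xi_b U < v" "u \<le> v" "v \<ge> 1" "v \<ge> 1 + T + 2 * E"
    using u T_nonneg E_pos by (auto simp: v_def)
  have "T / (2 * v\<^sup>2) \<le> T / 2"
    using T_nonneg v(3) by (intro divide_left_mono) auto
  hence Fv: "?F v \<ge> 0" using master_fun_ge[OF eos v(1)] v(4) by linarith
  have "continuous_on {u..v} ?F"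
    using u by (intro continuous_at_imp_continuous_on ballI
        DERIV_isCont[OF master_fun_DERIV(1)[OF eos]]) auto
  then obtain r where "u \<le> r" "?F r = 0"
    using IVT'[of ?F u 0 v] Fu Fv v by auto
  moreover have "x = y" if "x \<in> Omega2 U" "y \<in> Omega2 U" "?F x = ?F y" for x y
    using master_fun_strict_mono[OF eos, of x y] master_fun_strict_mono[OF eos, of y x] that
    by (cases x y rule: linorder_cases) (auto simp: Omega2_def)
  ultimately show ?thesis using u by (intro ex1I[of _ r]) (auto simp: Omega2_def)
qed

end

theorem theorem3p6:
  fixes U :: conservative
    and H :: "real \<Rightarrow> real \<Rightarrow> real"
    and \<xi> :: "nat \<Rightarrow> real"
  assumes "U \<in> admissible"
    and "general_eos H"
    and "(mono_on (Omega2 U) (deriv (master_fun H U)) \<or> antimono_on (Omega2 U) (deriv (master_fun H U)))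
         \<or> (\<exists>\<xi>_in \<in> Omega2 U. antimono_on {xi_b U<..\<xi>_in} (deriv (master_fun H U))
                            \<and> mono_on {\<xi>_in..} (deriv (master_fun H U)))"
    and "\<xi> 0 \<in> Omega3 H U"
    and "\<And>n. \<xi> (Suc n) = \<xi> n - master_fun H U (\<xi> n) / deriv (master_fun H U) (\<xi> n)"
  shows "(\<forall>n. \<xi> n \<in> Omega1 U \<and> density_at U (\<xi> n) > 0 \<and> pressure_at H U (\<xi> n) > 0
              \<and> norm (velocity_at U (\<xi> n)) < 1)
         \<and> \<xi> \<longlonglongrightarrow> xi_star H U"
proof -
  interpret admissible_state U by unfold_locales (rule assms(1))
  note eos = \<open>general_eos H\<close>
  have root: "master_fun H U (xi_star H U) = 0"
    using theI'[OF ex1_master_fun_root[OF eos]] by (simp add: xi_star_def)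
  have start: "xi_b U < \<xi> 0" "\<xi> 0 \<le> xi_star H U" using assms(4) by (auto simp: Omega3_def)
  note newton = newton_quasiconvex_derivative[of "xi_b U" "master_fun H U" "deriv (master_fun H U)",
      OF master_fun_DERIV[OF eos] mono_on_or_antimono_on_quasiconvex[OF assms(3)[unfolded Omega2_def]]
        root start assms(5)]
  \<comment> \<open>All four constraints hold throughout \<open>Omega2 U\<close>, so it is enough
    that the iterates never leave it, even after overshooting the root.\<close>
  have "\<xi> n \<in> Omega1 U \<and> density_at U (\<xi> n) > 0 \<and> pressure_at H U (\<xi> n) > 0
    \<and> norm (velocity_at U (\<xi> n)) < 1" for n
    using Omega2D[OF newton(1)] velocity_at_less_1 pressure_at_pos[OF eos newton(1)] D_pos
    by (simp add: density_at_eq)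
  thus ?thesis using newton(2) by blast
qed

end
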